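(* Let $p,r,\ell_0,m_0\in\mathbb{C}$ be such that $q^{2m}\neq -1$ for all $m\in m_0+\mathbb{Z}$, and $q^{2\ell}\neq 1$ and $q^{4\ell+2}\neq 1$ for all $\ell\in\ell_0+\mathbb{Z}$. Let $$V_{\ell_0,m_0}^{p,r}=\bigoplus_{\ell\in\ell_0+\mathbb{Z},\ m\in m_0+\mathbb{Z}}\mathbb{C}\,|\ell,m\rangle$$ be the complex vector space with basis $\{|\ell,m\rangle:\ell\in\ell_0+\mathbb{Z},\ m\in m_0+\mathbb{Z}\}$. Then the formulas $$I_{21}.|\ell,m\rangle=i[m]\,|\ell,m\rangle,$$ $$I_{32}.|\ell,m\rangle=a_{\ell,m}\,|\ell,m+1\rangle-|\ell,m-1\rangle,$$ $$I_{43}.|\ell,m\rangle=b_{\ell,m}\,|\ell+1,m\rangle-[\ell-m]\,|\ell-1,m\rangle+i\,c_{\ell,m}\,|\ell,m\rangle,$$ where $$a_{\ell,m}=\frac{[\ell+m+1][\ell-m]}{(q^m+q^{-m})(q^{m+1}+q^{-m-1})},$$ $$b_{\ell,m}=\frac{[p+\ell+2][p-\ell][\ell+r+1][\ell-r+1][\ell+m+1]}{[\ell+1]^2[2\ell+1][2\ell+3]},\qquad c_{\ell,m}=\frac{[p+1][r][m]}{[\ell+1][\ell]},$$ define a representation of $U_q^{\mathrm{tw}}(\mathfrak{so}_4)$ on $V_{\ell_0,m_0}^{p,r}$.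
   Context: Fix $h\in\mathbb{C}\setminus 2\pi i\mathbb{Q}$, where $i=\sqrt{-1}$, and put $q=\exp(h)$, so $q$ is not a root of unity. For $b\in\mathbb{C}$ put $q^b=\exp(hb)$ and $[b]=\frac{q^b-q^{-b}}{q-q^{-1}}$. The algebra $U_q^{\mathrm{tw}}(\mathfrak{so}_4)$ is the complex unital associative algebra generated by $I_{21},I_{32},I_{43}$ subject to $I_{21}I_{43}=I_{43}I_{21}$ and, for $j=2,3$, $$I_{j+1,j}^2I_{j,j-1}-[2]I_{j+1,j}I_{j,j-1}I_{j+1,j}+I_{j,j-1}I_{j+1,j}^2=-I_{j,j-1},$$ $$I_{j,j-1}^2I_{j+1,j}-[2]I_{j,j-1}I_{j+1,j}I_{j,j-1}+I_{j+1,j}I_{j,j-1}^2=-I_{j+1,j}.$$ *)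

theory Defs
  imports Complex_Main "HOL-Library.Poly_Mapping" "HOL-Library.FuncSet" "HOL-Algebra.QuotRing" "HOL-Algebra.Module"
begin

section \<open>q-numbers\<close>

definition qpow :: "complex \<Rightarrow> complex \<Rightarrow> complex" where
  "qpow h b = exp (h * b)"

definition qnum :: "complex \<Rightarrow> complex \<Rightarrow> complex" where
  "qnum h b = (qpow h b - qpow h (- b)) / (qpow h 1 - qpow h (- 1))"


section \<open>Complex unital associative algebras\<close>

text \<open>
  The \<^typ>\<open>('a, 'b) module\<close> record of HOL-Algebra carries a ring structure together with a scalar
  multiplication. It is used here both for complex algebras and, with the fields \<^const>\<open>mult\<close> and
  \<^const>\<open>one\<close> ignored as in HOL-Algebra, for complex vector spaces. (The locale \<^locale>\<open>algebra\<close> of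
  HOL-Algebra is restricted to commutative algebras.)
\<close>

definition alg_hom :: "(complex, 'a) module \<Rightarrow> (complex, 'b) module \<Rightarrow> ('a \<Rightarrow> 'b) set" where
  "alg_hom A B = {\<phi> \<in> ring_hom A B. \<forall>c. \<forall>x\<in>carrier A. \<phi> (c \<odot>\<^bsub>A\<^esub> x) = c \<odot>\<^bsub>B\<^esub> \<phi> x}"

text \<open>
  The algebra of linear endomorphisms of a vector space. As elsewhere in HOL-Algebra
  (\<open>BijGroup\<close>), maps are made unique as HOL functions by requiring them to be extensional.
\<close>

definition End_alg :: "(complex, 'v) module \<Rightarrow> (complex, 'v \<Rightarrow> 'v) module" where
  "End_alg V =
    \<lparr> carrier = {f \<in> carrier V \<rightarrow>\<^sub>E carrier V.
        (\<forall>v\<in>carrier V. \<forall>w\<in>carrier V. f (v \<oplus>\<^bsub>V\<^esub> w) = f v \<oplus>\<^bsub>V\<^esub> f w) \<and>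
        (\<forall>c. \<forall>v\<in>carrier V. f (c \<odot>\<^bsub>V\<^esub> v) = c \<odot>\<^bsub>V\<^esub> f v)},
      mult = (\<lambda>f g. compose (carrier V) f g),
      one = (\<lambda>v\<in>carrier V. v),
      zero = (\<lambda>v\<in>carrier V. \<zero>\<^bsub>V\<^esub>),
      add = (\<lambda>f g. \<lambda>v\<in>carrier V. f v \<oplus>\<^bsub>V\<^esub> g v),
      smult = (\<lambda>c f. \<lambda>v\<in>carrier V. c \<odot>\<^bsub>V\<^esub> f v) \<rparr>"

definition cscale :: "complex \<Rightarrow> ('a \<Rightarrow>\<^sub>0 complex) \<Rightarrow> ('a \<Rightarrow>\<^sub>0 complex)" (infixr \<open>*\<^sub>C\<close> 75) where
  "c *\<^sub>C x = Poly_Mapping.map ((*) c) x"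

lemma lookup_cscale: "Poly_Mapping.lookup (c *\<^sub>C x) k = c * Poly_Mapping.lookup x k"
  by (cases "Poly_Mapping.lookup x k = 0") (simp_all add: cscale_def Poly_Mapping.map.rep_eq)


section \<open>The free algebra on three generators\<close>

datatype gen = G21 | G32 | G43

text \<open>
  The free monoid, written additively: the convolution product on \<^typ>\<open>'a \<Rightarrow>\<^sub>0 'b\<close> is defined for an
  index type of class \<^class>\<open>monoid_add\<close> (not necessarily commutative).
\<close>

datatype gword = Word "gen list"

instantiation gword :: monoid_add
begin

definition zero_gword :: gword where "0 = Word []"

fun plus_gword :: "gword \<Rightarrow> gword \<Rightarrow> gword" where
  "Word u + Word v = Word (u @ v)"

instance
proof
  fix a b c :: gword
  show "a + b + c = a + (b + c)" by (cases a; cases b; cases c) simp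
  show "0 + a = a" by (cases a) (simp add: zero_gword_def)
  show "a + 0 = a" by (cases a) (simp add: zero_gword_def)
qed

end

type_synonym freepoly = "gword \<Rightarrow>\<^sub>0 complex"

definition free_alg :: "(complex, freepoly) module" where
  "free_alg = \<lparr> carrier = UNIV, mult = (*), one = 1, zero = 0, add = (+), smult = (*\<^sub>C) \<rparr>"

definition free_gen :: "gen \<Rightarrow> freepoly" where
  "free_gen g = Poly_Mapping.single (Word [g]) 1"

lemma smult_free_alg: "c \<odot>\<^bsub>free_alg\<^esub> x = c *\<^sub>C x"
  by (simp add: free_alg_def)

lemma ring_free_alg: "ring free_alg"
proof (rule ringI)
  show "abelian_group free_alg"
  proof (rule abelian_groupI)
    fix x assume "x \<in> carrier free_alg"
    show "\<exists>y\<in>carrier free_alg. y \<oplus>\<^bsub>free_alg\<^esub> x = \<zero>\<^bsub>free_alg\<^esub>"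
      by (intro bexI[of _ "- x"]) (simp_all add: free_alg_def)
  qed (simp_all add: free_alg_def algebra_simps)
  show "monoid free_alg"
    by unfold_locales (simp_all add: free_alg_def algebra_simps)
qed (simp_all add: free_alg_def algebra_simps)


section \<open>The twisted algebra\<close>

text \<open>The relator of \<open>x\<^sup>2 y - [2] x y x + y x\<^sup>2 = - y\<close>.\<close>

definition serre_rel :: "complex \<Rightarrow> freepoly \<Rightarrow> freepoly \<Rightarrow> freepoly" where
  "serre_rel h x y = x^2 * y - qnum h 2 *\<^sub>C (x * y * x) + y * x^2 + y"

definition Uq_relators :: "complex \<Rightarrow> freepoly set" where
  "Uq_relators h =
    {free_gen G21 * free_gen G43 - free_gen G43 * free_gen G21,
     serre_rel h (free_gen G32) (free_gen G21), serre_rel h (free_gen G21) (free_gen G32),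
     serre_rel h (free_gen G43) (free_gen G32), serre_rel h (free_gen G32) (free_gen G43)}"

definition Uq_ideal :: "complex \<Rightarrow> freepoly set" where
  "Uq_ideal h = Idl\<^bsub>free_alg\<^esub> (Uq_relators h)"

text \<open>The ring \<^term>\<open>free_alg Quot Uq_ideal h\<close>, extended by the induced scalar multiplication.\<close>

definition Uq_tw_so4 :: "complex \<Rightarrow> (complex, freepoly set) module" where
  "Uq_tw_so4 h = ring.extend (free_alg Quot Uq_ideal h)
     (module.fields (\<lambda>c X. \<Union>x\<in>X. Uq_ideal h +>\<^bsub>free_alg\<^esub> (c \<odot>\<^bsub>free_alg\<^esub> x)))"

definition Uq_gen :: "complex \<Rightarrow> gen \<Rightarrow> freepoly set" where
  "Uq_gen h g = Uq_ideal h +>\<^bsub>free_alg\<^esub> free_gen g"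

lemma Uq_tw_so4_simps:
  "carrier (Uq_tw_so4 h) = carrier (free_alg Quot Uq_ideal h)"
  "mult (Uq_tw_so4 h) = mult (free_alg Quot Uq_ideal h)"
  "one (Uq_tw_so4 h) = one (free_alg Quot Uq_ideal h)"
  "zero (Uq_tw_so4 h) = zero (free_alg Quot Uq_ideal h)"
  "add (Uq_tw_so4 h) = add (free_alg Quot Uq_ideal h)"
  "smult (Uq_tw_so4 h) = (\<lambda>c X. \<Union>x\<in>X. Uq_ideal h +>\<^bsub>free_alg\<^esub> (c \<odot>\<^bsub>free_alg\<^esub> x))"
  by (simp_all add: Uq_tw_so4_def ring.defs module.defs FactRing_def)

lemma ideal_Uq_ideal: "ideal (Uq_ideal h) free_alg"
  unfolding Uq_ideal_def
  by (rule ring.genideal_ideal[OF ring_free_alg]) (simp add: free_alg_def)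

lemma ring_Uq_tw_so4: "ring (Uq_tw_so4 h)"
proof -
  interpret Q: ring "free_alg Quot Uq_ideal h"
    by (rule ideal.quotient_is_ring[OF ideal_Uq_ideal])
  show ?thesis
  proof (rule ringI)
    show "abelian_group (Uq_tw_so4 h)"
      by (rule abelian_groupI; unfold Uq_tw_so4_simps)
        (simp_all only: Q.a_closed Q.zero_closed Q.a_assoc Q.a_comm Q.a_lcomm Q.l_zero Q.r_zero Q.add.l_inv_ex)
    show "monoid (Uq_tw_so4 h)"
      by (rule monoidI; unfold Uq_tw_so4_simps)
        (simp_all only: Q.m_closed Q.one_closed Q.m_assoc Q.l_one Q.r_one)
  qed (simp_all only: Uq_tw_so4_simps Q.l_distr Q.r_distr)
qed

lemma cscale_conv_times: "c *\<^sub>C x = Poly_Mapping.single 0 c * (x :: freepoly)"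
  by (simp add: cscale_def mult_map_scale_conv_mult)

lemma Uq_smult_coset:
  "c \<odot>\<^bsub>Uq_tw_so4 h\<^esub> (Uq_ideal h +>\<^bsub>free_alg\<^esub> x) = Uq_ideal h +>\<^bsub>free_alg\<^esub> (c *\<^sub>C x)"
proof -
  interpret I: ideal "Uq_ideal h" free_alg by (rule ideal_Uq_ideal)
  have coset: "Uq_ideal h +>\<^bsub>free_alg\<^esub> y = {u + y | u. u \<in> Uq_ideal h}" for y
    by (auto simp: a_r_coset_def' free_alg_def)
  have eq: "Uq_ideal h +>\<^bsub>free_alg\<^esub> (c *\<^sub>C z) = Uq_ideal h +>\<^bsub>free_alg\<^esub> (c *\<^sub>C x)"
    if z: "z \<in> Uq_ideal h +>\<^bsub>free_alg\<^esub> x" for z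
  proof -
    obtain u where u: "u \<in> Uq_ideal h" "z = u + x"
      using z by (auto simp: coset)
    have cu: "c *\<^sub>C u \<in> Uq_ideal h"
      using I.I_l_closed[OF u(1), of "Poly_Mapping.single 0 c"]
      by (simp add: cscale_conv_times free_alg_def)
    have "c *\<^sub>C z = c *\<^sub>C u + c *\<^sub>C x"
      by (simp only: cscale_conv_times u(2) distrib_left)
    then have "c *\<^sub>C z \<in> Uq_ideal h +>\<^bsub>free_alg\<^esub> (c *\<^sub>C x)"
      using cu by (auto simp: coset)
    then show ?thesis
      by (rule I.a_repr_independence[symmetric, OF _ _ I.a_subgroup]) (simp add: free_alg_def)
  qed
  have xx: "x \<in> Uq_ideal h +>\<^bsub>free_alg\<^esub> x"
    by (rule I.a_rcos_self) (simp add: free_alg_def)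
  show ?thesis
    unfolding Uq_tw_so4_simps smult_free_alg by (rule UN_constant_eq[OF xx ballI[OF eq]])
qed


section \<open>The vector space with basis \<open>|\<ell>, m\<rangle>\<close>\<close>

definition int_translates :: "complex \<Rightarrow> complex set" where
  "int_translates z = range (\<lambda>k::int. z + of_int k)"

text \<open>
  The direct sum of the lines spanned by the \<open>|\<ell>, m\<rangle>\<close> consists of the finitely supported functions
  on \<open>(\<ell>\<^sub>0 + \<int>) \<times> (m\<^sub>0 + \<int>)\<close>. The parameters \<open>p\<close> and \<open>r\<close> enter only through the action, not through the space.
\<close>

definition V_space :: "complex \<Rightarrow> complex \<Rightarrow> (complex, complex \<times> complex \<Rightarrow>\<^sub>0 complex) module" where
  "V_space l0 m0 =
    \<lparr> carrier = {v. Poly_Mapping.keys v \<subseteq> int_translates l0 \<times> int_translates m0},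
      mult = undefined, one = undefined, zero = 0, add = (+), smult = (*\<^sub>C) \<rparr>"

definition ket :: "complex \<Rightarrow> complex \<Rightarrow> (complex \<times> complex \<Rightarrow>\<^sub>0 complex)" where
  "ket l m = Poly_Mapping.single (l, m) 1"

definition coeff_a :: "complex \<Rightarrow> complex \<Rightarrow> complex \<Rightarrow> complex" where
  "coeff_a h l m = qnum h (l + m + 1) * qnum h (l - m) /
    ((qpow h m + qpow h (- m)) * (qpow h (m + 1) + qpow h (- m - 1)))"

definition coeff_b :: "complex \<Rightarrow> complex \<Rightarrow> complex \<Rightarrow> complex \<Rightarrow> complex \<Rightarrow> complex" where
  "coeff_b h p r l m =
    qnum h (p + l + 2) * qnum h (p - l) * qnum h (l + r + 1) * qnum h (l - r + 1) * qnum h (l + m + 1) /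
    ((qnum h (l + 1))^2 * qnum h (2 * l + 1) * qnum h (2 * l + 3))"

definition coeff_c :: "complex \<Rightarrow> complex \<Rightarrow> complex \<Rightarrow> complex \<Rightarrow> complex \<Rightarrow> complex" where
  "coeff_c h p r l m = qnum h (p + 1) * qnum h r * qnum h m / (qnum h (l + 1) * qnum h l)"

end

theory Submission
  imports Defs
begin

text \<open>
  A representation of an algebra given by generators and relations is a choice of operators that
  satisfy the relations, so the content of the theorem is that the three displayed operators satisfy
  the five defining relations of \<open>U\<^sub>q\<^sup>t\<^sup>w(so\<^sub>4)\<close> on every basis vector; the abstract part
  (\<open>uq_rep_alg_hom\<close>, \<open>alg_hom_eqI\<close>) turns this into existence and uniqueness of the homomorphism.

  Write \<open>s = l + m\<close> and \<open>t = l - m\<close>. The coefficients factor as \<open>a = A\<^sub>m [s+1][t]\<close>, \<open>b = B\<^sub>l [s+1]\<close>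
  and \<open>c = C\<^sub>l [m]\<close>, where \<open>A\<close> depends on \<open>m\<close> only and \<open>B\<close>, \<open>C\<close> depend on \<open>l\<close> only
  (\<open>a_factor\<close>, \<open>b_factor\<close>, \<open>c_factor\<close>). The commutation of \<open>I\<^sub>2\<^sub>1\<close> and \<open>I\<^sub>4\<^sub>3\<close> is clear, as \<open>I\<^sub>4\<^sub>3\<close>
  preserves \<open>m\<close>. A cubic relator
  \<open>x\<^sup>2 y - [2] x y x + y x\<^sup>2 + y\<close> is linear in \<open>y\<close>, and each of \<open>I\<^sub>3\<^sub>2\<close>, \<open>I\<^sub>4\<^sub>3\<close> is a sum of pieces that shift
  at most one label, by a fixed amount. For one such piece the relator becomes five scalar equations
  along a chain of vectors (\<open>serre_op_chain\<close>), one for each of the displacements \<open>2, 1, 0, -1, -2\<close>.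

  The displacements \<open>\<plusminus>2\<close> always reduce to \<open>[2][a] = [a+1] + [a-1]\<close>. For the relation that is quadratic in
  \<open>I\<^sub>4\<^sub>3\<close>, the displacements \<open>\<plusminus>1\<close> reduce to a three-term identity between q-numbers
  (\<open>qnum_three_term\<close>), and the displacement \<open>0\<close> collapses to
  \<open>B\<^sub>l [2l+3] - B\<^sub>l\<^sub>-\<^sub>1 [2l-1] = C\<^sub>l\<^sup>2 - 1\<close> (\<open>b_factor_relation\<close>). For the relation that is quadratic in
  \<open>I\<^sub>3\<^sub>2\<close>, the displacement \<open>0\<close> collapses to \<open>A\<^sub>m [2m+2] - A\<^sub>m\<^sub>-\<^sub>1 [2m-2] = 1\<close>
  (\<open>a_factor_relation\<close>) for the pieces of \<open>I\<^sub>4\<^sub>3\<close> that change \<open>l\<close>, and to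
  \<open>a_factor_weight_relation\<close> for its diagonal piece and for \<open>I\<^sub>2\<^sub>1\<close>. For the relation quadratic in the
  diagonal operator \<open>I\<^sub>2\<^sub>1\<close>, only the displacement \<open>0\<close> is present, and it says that
  \<open>[m+1]\<^sup>2 - [2][m][m+1] + [m]\<^sup>2 = 1\<close> (\<open>qnum_neighbours_quadratic\<close>).
\<close>

section \<open>Linear maps given on a basis\<close>

lemma cscale_simps [simp]:
  "c *\<^sub>C (x + y) = c *\<^sub>C x + c *\<^sub>C y" "c *\<^sub>C (x - y) = c *\<^sub>C x - c *\<^sub>C y" "c *\<^sub>C (- x) = - (c *\<^sub>C x)"
  "(c + d) *\<^sub>C x = c *\<^sub>C x + d *\<^sub>C x"
  "c *\<^sub>C d *\<^sub>C x = (c * d) *\<^sub>C x" "1 *\<^sub>C x = x" "0 *\<^sub>C x = 0" "c *\<^sub>C 0 = 0"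
  by (rule poly_mapping_eqI; simp add: lookup_cscale lookup_add lookup_minus lookup_uminus algebra_simps)+

lemma keys_cscale: "Poly_Mapping.keys (c *\<^sub>C x) \<subseteq> Poly_Mapping.keys x"
  by (auto simp: in_keys_iff lookup_cscale)

definition lin :: "('a \<Rightarrow> ('b \<Rightarrow>\<^sub>0 complex)) \<Rightarrow> ('a \<Rightarrow>\<^sub>0 complex) \<Rightarrow> ('b \<Rightarrow>\<^sub>0 complex)" where
  "lin T v = (\<Sum>k\<in>Poly_Mapping.keys v. Poly_Mapping.lookup v k *\<^sub>C T k)"

lemma lin_superset:
  assumes "finite K" "Poly_Mapping.keys v \<subseteq> K"
  shows "lin T v = (\<Sum>k\<in>K. Poly_Mapping.lookup v k *\<^sub>C T k)"
  unfolding lin_def by (rule sum.mono_neutral_left) (use assms in \<open>auto simp: in_keys_iff\<close>)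

lemma lin_add: "lin T (v + w) = lin T v + lin T w"
proof -
  let ?K = "Poly_Mapping.keys v \<union> Poly_Mapping.keys w"
  have "lin T u = (\<Sum>k\<in>?K. Poly_Mapping.lookup u k *\<^sub>C T k)" if "u \<in> {v, w, v + w}" for u
    by (rule lin_superset) (use that keys_add[of v w] in auto)
  then show ?thesis by (simp add: lookup_add sum.distrib)
qed

lemma cscale_sum: "c *\<^sub>C (\<Sum>k\<in>K. g k) = (\<Sum>k\<in>K. c *\<^sub>C g k)"
  by (induction K rule: infinite_finite_induct) simp_all

lemma lin_cscale: "lin T (c *\<^sub>C v) = c *\<^sub>C lin T v"
  using lin_superset[OF finite_keys keys_cscale, of T c v]
  by (simp add: lookup_cscale cscale_sum lin_def)

lemma lin_0: "lin T 0 = 0"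
  by (simp add: lin_def)

lemma lin_diff: "lin T (v - w) = lin T v - lin T w"
  using lin_add[of T "v - w" w] by simp

lemma lin_single: "lin T (Poly_Mapping.single k c) = c *\<^sub>C T k"
  by (cases "c = 0") (simp_all add: lin_def)

lemma lin_basis: "lin (\<lambda>k. Poly_Mapping.single k 1) v = v"
  by (rule poly_mapping_eqI)
    (auto simp: lin_def lookup_sum lookup_cscale lookup_single when_def in_keys_iff if_distrib cong: if_cong)

text \<open>
  Properties of linear maps, here and below, are checked on basis vectors; restricting the support to \<open>S\<close>
  makes the principle apply to the subspace spanned by a part of the basis.
\<close>

lemma basis_induct [consumes 1, case_names zero add cscale basis]:
  assumes "Poly_Mapping.keys v \<subseteq> S"
    and zero: "P 0"
    and add: "\<And>v w. Poly_Mapping.keys v \<subseteq> S \<Longrightarrow> Poly_Mapping.keys w \<subseteq> S \<Longrightarrow> P v \<Longrightarrow> P w \<Longrightarrow> P (v + w)"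
    and cscale: "\<And>c v. Poly_Mapping.keys v \<subseteq> S \<Longrightarrow> P v \<Longrightarrow> P (c *\<^sub>C v)"
    and basis: "\<And>k. k \<in> S \<Longrightarrow> P (Poly_Mapping.single k 1)"
  shows "P v"
proof -
  have "P (\<Sum>k\<in>K. f k *\<^sub>C Poly_Mapping.single k 1)
      \<and> Poly_Mapping.keys (\<Sum>k\<in>K. f k *\<^sub>C Poly_Mapping.single k (1::complex)) \<subseteq> S"
    if "finite K" "K \<subseteq> S" for K f
    using that
  proof (induction K rule: finite_induct)
    case (insert k K)
    have k: "Poly_Mapping.keys (f k *\<^sub>C Poly_Mapping.single k (1::complex)) \<subseteq> S"
      using keys_cscale[of "f k" "Poly_Mapping.single k 1"] insert.prems by auto
    have "P (f k *\<^sub>C Poly_Mapping.single k 1)"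
      using insert.prems by (intro cscale basis) auto
    then show ?case
      using insert k keys_add[of "f k *\<^sub>C Poly_Mapping.single k 1"
          "\<Sum>k\<in>K. f k *\<^sub>C Poly_Mapping.single k (1::complex)"]
      by (auto intro!: add)
  qed (simp add: zero)
  from this[OF finite_keys assms(1), of "Poly_Mapping.lookup v"] show ?thesis
    using lin_basis[of v] by (simp add: lin_def)
qed

lemmas poly_mapping_basis_induct [case_names zero add cscale basis] = basis_induct[OF subset_UNIV]

lemma lin_keys:
  assumes "Poly_Mapping.keys v \<subseteq> S" "\<And>k. k \<in> S \<Longrightarrow> Poly_Mapping.keys (T k) \<subseteq> S'"
  shows "Poly_Mapping.keys (lin T v) \<subseteq> S'"
  using assms(1)
proof (induction v rule: basis_induct)
  case (add v w)
  then show ?case using keys_add[of "lin T v" "lin T w"] by (auto simp: lin_add)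
next
  case (cscale c v)
  then show ?case using keys_cscale[of c "lin T v"] by (auto simp: lin_cscale)
qed (simp_all add: lin_0 lin_single assms(2))

section \<open>Identities between q-numbers\<close>

lemma qpow_nonzero: "qpow h a \<noteq> 0"
  by (simp add: qpow_def)

lemma qpow_add: "qpow h (a + b) = qpow h a * qpow h b"
  by (simp add: qpow_def distrib_left exp_add)

lemma qpow_minus: "qpow h (- a) = inverse (qpow h a)"
  by (simp add: qpow_def exp_minus)

lemma qpow_diff: "qpow h (a - b) = qpow h a * inverse (qpow h b)"
  using qpow_add[of h a "- b"] by (simp add: qpow_minus)

lemma qpow_double: "qpow h (2 * a) = (qpow h a)\<^sup>2"
  by (metis mult_2 qpow_add power2_eq_square)

lemma qnum_minus: "qnum h (- a) = - qnum h a"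
  by (simp add: qnum_def minus_divide_left)

lemma qnum_eq_minus: "a + b = 0 \<Longrightarrow> qnum h a = - qnum h b"
  using qnum_minus[of h b] by (simp add: add_eq_0_iff2)

text \<open>
  Since \<open>q - q\<^sup>-\<^sup>1\<close> is the denominator of every q-number, its being nonzero is what gives \<open>[1] = 1\<close> and,
  with it, the unit-shift rules below.
\<close>

locale q_generic =
  fixes h :: complex
  assumes q_minus_inv: "qpow h 1 - qpow h (- 1) \<noteq> 0"
begin

abbreviation n where "n \<equiv> qnum h"

lemma qnum_1: "n 1 = 1"
  using q_minus_inv by (simp add: qnum_def)

lemma two_times_qnum: "n 2 * n a = n (a + 1) + n (a - 1)"
proof -
  define q x where "q = qpow h 1" and "x = qpow h a"
  have nz: "q \<noteq> 0" "x \<noteq> 0" and d: "q - inverse q \<noteq> 0"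
    using q_minus_inv by (simp_all add: q_def x_def qpow_nonzero qpow_minus)
  have "n 2 = q + inverse q"
  proof -
    have "n 2 = (q * q - inverse (q * q)) / (q - inverse q)"
      unfolding qnum_def qpow_minus one_add_one[symmetric] qpow_add q_def ..
    also have "q * q - inverse (q * q) = (q + inverse q) * (q - inverse q)"
      using nz by (simp add: algebra_simps)
    finally show ?thesis using d by simp
  qed
  moreover have "n (a + 1) + n (a - 1)
      = (x * q - inverse (x * q) + (x * inverse q - inverse (x * inverse q))) / (q - inverse q)"
    unfolding qnum_def qpow_minus qpow_add qpow_diff q_def x_def add_divide_distrib ..
  moreover have "x * q - inverse (x * q) + (x * inverse q - inverse (x * inverse q))
      = (q + inverse q) * (x - inverse x)"
    by (simp add: algebra_simps)
  ultimately show ?thesis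
    by (simp add: qnum_def qpow_minus q_def x_def)
qed

text \<open>
  Multiplied by \<open>(q - q\<^sup>-\<^sup>1)\<^sup>2\<close>, the product \<open>[a][b]\<close> is \<open>q\<^sup>a\<^sup>+\<^sup>b + q\<^sup>-\<^sup>a\<^sup>-\<^sup>b\<close> minus a term depending only on
  \<open>a - b\<close>, so that term cancels when both arguments are shifted by the same amount. The exchange
  rule and the formula for differences of squares are the instances used below.
\<close>

lemma qnum_mult_shift: "n (a + c) * n (b + c) - n a * n b = n c * n (a + b + c)"
proof -
  define x y z where "x = qpow h a" and "y = qpow h b" and "z = qpow h c"
  have nz: "x \<noteq> 0" "y \<noteq> 0" "z \<noteq> 0"
    by (simp_all add: x_def y_def z_def qpow_nonzero)
  have "(x * z - inverse (x * z)) * (y * z - inverse (y * z)) - (x - inverse x) * (y - inverse y)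
      = (z - inverse z) * (x * y * z - inverse (x * y * z))"
    using nz by (simp add: field_simps)
  then show ?thesis
    unfolding qnum_def qpow_minus qpow_add x_def y_def z_def
    by (simp add: diff_divide_distrib[symmetric])
qed

lemma qnum_mult_shift_1: "n (a + 1) * n (b + 1) = n a * n b + n (a + b + 1)"
  using qnum_mult_shift[of a 1 b] by (simp add: qnum_1 algebra_simps)

lemma qnum_mult_exchange: "n (a + 1) * n b = n a * n (b + 1) - n (a - b)"
proof -
  have "- b - 1 = - (b + 1)" by simp
  then show ?thesis
    using qnum_mult_shift_1[of a "- (b + 1)"] qnum_minus[of h b] qnum_minus[of h "b + 1"]
    by (simp add: algebra_simps)
qed

lemma qnum_double: "n (2 * a) = n a * (qpow h a + qpow h (- a))"
proof -
  have "qpow h (2 * a) - qpow h (- (2 * a)) = (qpow h a - qpow h (- a)) * (qpow h a + qpow h (- a))"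
    unfolding qpow_minus qpow_double by (simp add: power2_eq_square algebra_simps)
  then show ?thesis by (simp add: qnum_def)
qed

lemma qnum_neighbours_diff: "n (a + 1) - n (a - 1) = qpow h a + qpow h (- a)"
proof -
  have "n (a + 1) - n (a - 1) = (qpow h a + qpow h (- a)) * (qpow h 1 - qpow h (- 1)) / (qpow h 1 - qpow h (- 1))"
    unfolding qnum_def diff_divide_distrib[symmetric]
    by (simp add: qpow_add qpow_diff qpow_minus algebra_simps)
  then show ?thesis using q_minus_inv by simp
qed

lemma qnum_square_diff: "(n a)\<^sup>2 - (n b)\<^sup>2 = n (a + b) * n (a - b)"
  using qnum_mult_shift[of b "a - b" b] by (simp add: power2_eq_square algebra_simps)

lemma qnum_nonzero:
  assumes "qpow h (2 * a) \<noteq> 1" shows "n a \<noteq> 0"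
proof
  assume "n a = 0"
  then have "qpow h a = inverse (qpow h a)"
    using q_minus_inv by (simp add: qnum_def qpow_minus)
  then have "qpow h a * qpow h a = 1"
    by (metis qpow_nonzero right_inverse)
  with assms show False by (simp add: qpow_double power2_eq_square)
qed

text \<open>
  This is what remains of the relation quadratic in \<open>I\<^sub>4\<^sub>3\<close> when the label \<open>l\<close> moves by one. Moving the
  unit shift between the factors of \<open>[l+1][t]\<close> and of \<open>[l+2][t]\<close> costs \<open>[m]\<close> and \<open>[m+1]\<close>, and the two
  corrections cancel.
\<close>

lemma qnum_three_term:
  assumes "l = t + m"
  shows "n (l + 1) * (n t * n (m + 1) + n (t + 1) * n m)
    = n (t + 1) * n (m + 1) * n l + n t * n m * n (l + 2)"
proof -
  have "n (l + 1) * n t = n l * n (t + 1) - n m"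
    using qnum_mult_exchange[of l t] assms by simp
  moreover have "n (l + 2) * n t = n (l + 1) * n (t + 1) - n (m + 1)"
    using qnum_mult_exchange[of "l + 1" t] assms by (simp add: algebra_simps)
  ultimately show ?thesis by Groebner_Basis.algebra
qed

end

section \<open>The cubic relation on chains of vectors\<close>

text \<open>
  The relator \<open>x\<^sup>2 y - c x y x + y x\<^sup>2 + y\<close> evaluated in operators, with \<open>c\<close> in the place of \<open>[2]\<close>.
\<close>

definition serre_op ::
  "complex \<Rightarrow> (('a \<Rightarrow>\<^sub>0 complex) \<Rightarrow> ('a \<Rightarrow>\<^sub>0 complex)) \<Rightarrow> (('a \<Rightarrow>\<^sub>0 complex) \<Rightarrow> ('a \<Rightarrow>\<^sub>0 complex))
    \<Rightarrow> ('a \<Rightarrow>\<^sub>0 complex) \<Rightarrow> ('a \<Rightarrow>\<^sub>0 complex)" where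
  "serre_op c x y v = x (x (y v)) - c *\<^sub>C x (y (x v)) + y (x (x v)) + y v"

lemma lin_plus: "lin (\<lambda>k. S k + T k) v = lin S v + lin T v"
  by (simp add: lin_def sum.distrib lookup_add)

lemma serre_op_plus:
  "serre_op c (lin X) (lin (\<lambda>k. S k + T k)) v = serre_op c (lin X) (lin S) v + serre_op c (lin X) (lin T) v"
  by (simp add: serre_op_def lin_plus lin_add algebra_simps)

text \<open>
  Here \<open>x\<close> acts tridiagonally along two chains of vectors, and \<open>y\<close> maps the first chain to the second
  without moving the position. The assumptions \<open>up2\<close>, \<open>up1\<close>, \<open>fix0\<close>, \<open>down1\<close>, \<open>down2\<close> say that the
  coefficients of \<open>\<psi> (k + 2)\<close>, ..., \<open>\<psi> (k - 2)\<close> in the relator vanish. They are required only at the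
  position \<open>k\<close>, because the identities between the coefficients of the representation hold only where
  no denominator vanishes.
\<close>

lemma serre_op_chain:
  fixes \<phi> \<psi> :: "complex \<Rightarrow> ('a \<Rightarrow>\<^sub>0 complex)"
  assumes x_phi: "\<And>k. lin X (\<phi> k) = b k *\<^sub>C \<phi> (k + 1) + d k *\<^sub>C \<phi> (k - 1) + e k *\<^sub>C \<phi> k"
    and x_psi: "\<And>k. lin X (\<psi> k) = b' k *\<^sub>C \<psi> (k + 1) + d' k *\<^sub>C \<psi> (k - 1) + e' k *\<^sub>C \<psi> k"
    and y_phi: "\<And>k. lin Y (\<phi> k) = f k *\<^sub>C \<psi> k"
    and up2: "f k * b' k * b' (k + 1) - c * (b k * f (k + 1) * b' (k + 1)) + b k * b (k + 1) * f (k + 2) = 0"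
    and up1: "f k * b' k * (e' k + e' (k + 1)) - c * (b k * f (k + 1) * e' (k + 1) + e k * f k * b' k)
        + b k * (e k + e (k + 1)) * f (k + 1) = 0"
    and fix0: "f k * (b' k * d' (k + 1) + d' k * b' (k - 1) + e' k * e' k)
        - c * (b k * f (k + 1) * d' (k + 1) + d k * f (k - 1) * b' (k - 1) + e k * f k * e' k)
        + (b k * d (k + 1) + d k * b (k - 1) + e k * e k) * f k + f k = 0"
    and down1: "f k * d' k * (e' k + e' (k - 1)) - c * (d k * f (k - 1) * e' (k - 1) + e k * f k * d' k)
        + d k * (e k + e (k - 1)) * f (k - 1) = 0"
    and down2: "f k * d' k * d' (k - 1) - c * (d k * f (k - 1) * d' (k - 1)) + d k * d (k - 1) * f (k - 2) = 0"
  shows "serre_op c (lin X) (lin Y) (\<phi> k) = 0"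
proof (rule poly_mapping_eqI)
  fix j
  define z where "z i = Poly_Mapping.lookup (\<psi> i) j" for i
  have k2: "k + 1 + 1 = k + 2" "k - 1 - 1 = k - 2" by simp_all
  have "Poly_Mapping.lookup (serre_op c (lin X) (lin Y) (\<phi> k)) j =
      (f k * b' k * b' (k + 1) - c * (b k * f (k + 1) * b' (k + 1)) + b k * b (k + 1) * f (k + 2)) * z (k + 2)
    + (f k * b' k * (e' k + e' (k + 1)) - c * (b k * f (k + 1) * e' (k + 1) + e k * f k * b' k)
        + b k * (e k + e (k + 1)) * f (k + 1)) * z (k + 1)
    + (f k * (b' k * d' (k + 1) + d' k * b' (k - 1) + e' k * e' k)
        - c * (b k * f (k + 1) * d' (k + 1) + d k * f (k - 1) * b' (k - 1) + e k * f k * e' k)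
        + (b k * d (k + 1) + d k * b (k - 1) + e k * e k) * f k + f k) * z k
    + (f k * d' k * (e' k + e' (k - 1)) - c * (d k * f (k - 1) * e' (k - 1) + e k * f k * d' k)
        + d k * (e k + e (k - 1)) * f (k - 1)) * z (k - 1)
    + (f k * d' k * d' (k - 1) - c * (d k * f (k - 1) * d' (k - 1)) + d k * d (k - 1) * f (k - 2)) * z (k - 2)"
    by (simp add: serre_op_def lin_add lin_cscale x_phi x_psi y_phi lookup_add lookup_minus lookup_cscale
        k2 flip: z_def) (simp add: algebra_simps)
  then show "Poly_Mapping.lookup (serre_op c (lin X) (lin Y) (\<phi> k)) j = Poly_Mapping.lookup 0 j"
    using up2 up1 fix0 down1 down2 by simp
qed

section \<open>The coefficients and the relations on basis vectors\<close>

lemma int_translates_step: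
  assumes "z \<in> int_translates w" shows "z + 1 \<in> int_translates w" "z - 1 \<in> int_translates w"
proof -
  obtain k where k: "z = w + of_int k" using assms by (auto simp: int_translates_def)
  have "z + 1 = w + of_int (k + 1)" "z - 1 = w + of_int (k - 1)" using k by simp_all
  then show "z + 1 \<in> int_translates w" "z - 1 \<in> int_translates w"
    unfolding int_translates_def by blast+
qed

locale so4_params = q_generic +
  fixes p r l0 m0 :: complex
  assumes m_regular: "m \<in> int_translates m0 \<Longrightarrow> qpow h (2 * m) \<noteq> - 1"
    and l_regular: "l \<in> int_translates l0 \<Longrightarrow> qpow h (2 * l) \<noteq> 1 \<and> qpow h (4 * l + 2) \<noteq> 1"
begin

lemma qnum_l_nonzero:
  assumes "l \<in> int_translates l0"
  shows "n l \<noteq> 0" "n (l + 1) \<noteq> 0" "n (2 * l + 1) \<noteq> 0"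
  using qnum_nonzero l_regular[OF assms] l_regular[OF int_translates_step(1)[OF assms]]
    qnum_nonzero[of "2 * l + 1"]
  by (simp_all add: algebra_simps)

lemma qpow_m_nonzero:
  assumes "m \<in> int_translates m0"
  shows "qpow h m + qpow h (- m) \<noteq> 0"
proof
  assume "qpow h m + qpow h (- m) = 0"
  then have "qpow h m * (qpow h m + inverse (qpow h m)) = 0"
    by (simp add: qpow_minus)
  then have "qpow h (2 * m) = - 1"
    by (simp add: qpow_double power2_eq_square distrib_left qpow_nonzero add_eq_0_iff2)
  with m_regular[OF assms] show False ..
qed

text \<open>
  The factors of \<open>a\<close>, \<open>b\<close>, \<open>c\<close> that remain when the q-numbers mixing \<open>l\<close> and \<open>m\<close>, and \<open>[m]\<close> in the case
  of \<open>c\<close>, are split off.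
\<close>

definition a_factor where
  "a_factor m = 1 / ((qpow h m + qpow h (- m)) * (qpow h (m + 1) + qpow h (- (m + 1))))"

definition b_factor where
  "b_factor l = n (p + l + 2) * n (p - l) * n (l + r + 1) * n (l - r + 1)
   / ((n (l + 1))\<^sup>2 * n (2 * l + 1) * n (2 * l + 3))"

definition c_factor where
  "c_factor l = n (p + 1) * n r / (n (l + 1) * n l)"

lemma coeff_a_eq: "coeff_a h l m = a_factor m * n (l + m + 1) * n (l - m)"
proof -
  have "- (m + 1) = - m - 1" by simp
  then show ?thesis by (simp add: coeff_a_def a_factor_def)
qed

lemma coeff_b_eq: "coeff_b h p r l m = b_factor l * n (l + m + 1)"
  by (simp add: coeff_b_def b_factor_def)

lemma coeff_c_eq: "coeff_c h p r l m = c_factor l * n m"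
  by (simp add: coeff_c_def c_factor_def)

text \<open>
  Since \<open>[2a] = [a](q\<^sup>a + q\<^sup>-\<^sup>a)\<close>, both terms have the denominator \<open>q\<^sup>m + q\<^sup>-\<^sup>m\<close>, which is also the
  difference \<open>[m+1] - [m-1]\<close> of the numerators.
\<close>

lemma a_factor_relation:
  assumes "m \<in> int_translates m0"
  shows "a_factor m * n (2 * m + 2) - a_factor (m - 1) * n (2 * m - 2) = 1"
proof -
  note nz = qpow_m_nonzero[OF assms] qpow_m_nonzero[OF int_translates_step(1)[OF assms]]
    qpow_m_nonzero[OF int_translates_step(2)[OF assms]]
  have "a_factor m * n (2 * m + 2) = n (m + 1) / (qpow h m + qpow h (- m))"
    using qnum_double[of "m + 1"] nz by (simp add: a_factor_def)
  moreover have "a_factor (m - 1) * n (2 * m - 2) = n (m - 1) / (qpow h m + qpow h (- m))"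
    using qnum_double[of "m - 1"] nz by (simp add: a_factor_def right_diff_distrib)
  ultimately show ?thesis
    using qnum_neighbours_diff[of m] nz(1) by (simp add: diff_divide_distrib[symmetric])
qed

text \<open>
  The displacement-zero equation for an operator that is diagonal with eigenvalues proportional to
  \<open>[m]\<close>: this serves \<open>I\<^sub>2\<^sub>1\<close> as well as the diagonal part of \<open>I\<^sub>4\<^sub>3\<close>.
\<close>

lemma a_factor_weight_relation:
  assumes "m \<in> int_translates m0"
  shows "a_factor m * n (l + m + 1) * n (l - m) * (n (m + 2) - n m)
    - a_factor (m - 1) * n (l + m) * n (l - m + 1) * (n m - n (m - 2)) + n m = 0"
proof -
  note nz = qpow_m_nonzero[OF assms] qpow_m_nonzero[OF int_translates_step(1)[OF assms]]
    qpow_m_nonzero[OF int_translates_step(2)[OF assms]]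
  let ?w = "qpow h m + qpow h (- m)"
  have "a_factor m * (n (m + 2) - n m) = 1 / ?w"
    using qnum_neighbours_diff[of "m + 1"] nz by (simp add: a_factor_def add.assoc)
  moreover have "a_factor (m - 1) * (n m - n (m - 2)) = 1 / ?w"
    using qnum_neighbours_diff[of "m - 1"] nz by (simp add: a_factor_def diff_diff_eq)
  moreover have "n (l + m) * n (l - m + 1) - n (l + m + 1) * n (l - m) = n m * ?w"
    using qnum_mult_exchange[of "l + m" "l - m"] qnum_double[of m] by simp
  moreover have "1 / ?w * ?w = 1"
    using nz(1) by simp
  ultimately show ?thesis
    by Groebner_Basis.algebra
qed

text \<open>
  With \<open>x = [p+1]\<^sup>2\<close>, \<open>y = [r]\<^sup>2\<close>, \<open>a = [l+1]\<^sup>2\<close> and \<open>b = [l]\<^sup>2\<close>, the formula for differences of squares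
  turns the numerators of \<open>b_factor l\<close> and \<open>b_factor (l - 1)\<close> into \<open>(x - a)(a - y)\<close> and
  \<open>(x - b)(b - y)\<close>. As \<open>(x - a)(a - y) / a = x + y - x y / a - a\<close>, the difference of the two terms is
  \<open>(a - b)(x y / (a b) - 1)\<close> divided by \<open>[2l+1]\<close>. This is \<open>x y / (a b) - 1\<close>, because
  \<open>a - b = [2l+1]\<close>, and \<open>x y / (a b)\<close> is the square of \<open>c_factor l\<close>.
\<close>

lemma b_factor_relation:
  assumes "l \<in> int_translates l0"
  shows "b_factor l * n (2 * l + 3) - b_factor (l - 1) * n (2 * l - 1) - (c_factor l)\<^sup>2 + 1 = 0"
proof -
  note nz = qnum_l_nonzero[OF assms] qnum_l_nonzero[OF int_translates_step(1)[OF assms]]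
    qnum_l_nonzero[OF int_translates_step(2)[OF assms]]
  define x y where "x = (n (p + 1))\<^sup>2" and "y = (n r)\<^sup>2"
  have num: "n (p + l + 2) * n (p - l) = x - (n (l + 1))\<^sup>2"
    "n (l + r + 1) * n (l - r + 1) = (n (l + 1))\<^sup>2 - y" for l
    using qnum_square_diff[of "p + 1" "l + 1"] qnum_square_diff[of "l + 1" r]
    by (simp_all add: x_def y_def algebra_simps)
  have b: "b_factor l
      = (x - (n (l + 1))\<^sup>2) * ((n (l + 1))\<^sup>2 - y) / ((n (l + 1))\<^sup>2 * n (2 * l + 1) * n (2 * l + 3))" for l
    unfolding b_factor_def num[symmetric] by (simp add: mult.assoc)
  have nz3: "n (2 * l + 3) \<noteq> 0" "n (2 * l - 1) \<noteq> 0"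
    using nz(6,9) by (simp_all add: algebra_simps)
  have b1: "b_factor l * n (2 * l + 3)
      = (x - (n (l + 1))\<^sup>2) * ((n (l + 1))\<^sup>2 - y) / ((n (l + 1))\<^sup>2 * n (2 * l + 1))"
    using nz3 by (simp add: b)
  have b2: "b_factor (l - 1) * n (2 * l - 1) = (x - (n l)\<^sup>2) * ((n l)\<^sup>2 - y) / ((n l)\<^sup>2 * n (2 * l + 1))"
  proof -
    have "2 * (l - 1) + 1 = 2 * l - 1" "2 * (l - 1) + 3 = 2 * l + 1" by simp_all
    then show ?thesis using nz3 by (simp add: b add.commute)
  qed
  have c: "(c_factor l)\<^sup>2 = x * y / ((n (l + 1))\<^sup>2 * (n l)\<^sup>2)"
    by (simp add: c_factor_def x_def y_def power_divide power_mult_distrib)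
  have sq: "n (2 * l + 1) = (n (l + 1))\<^sup>2 - (n l)\<^sup>2"
    using qnum_square_diff[of "l + 1" l] by (simp add: qnum_1 algebra_simps)
  have "(x - a) * (a - y) / (a * c) - (x - b) * (b - y) / (b * c) - x * y / (a * b) + 1 = 0"
    if "a \<noteq> 0" "b \<noteq> 0" "c \<noteq> 0" "c = a - b" for a b c
  proof -
    have "(x - a) * (a - y) / (a * c) - (x - b) * (b - y) / (b * c) - x * y / (a * b) + 1
      = ((x - a) * (a - y) * b - (x - b) * (b - y) * a - x * y * c + a * b * c) / (a * b * c)"
      using that(1-3) by (simp add: field_simps)
    also have "(x - a) * (a - y) * b - (x - b) * (b - y) * a - x * y * c + a * b * c = 0"
      unfolding that(4) by (simp add: algebra_simps)
    finally show ?thesis by simp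
  qed
  then show ?thesis
    unfolding b1 b2 c using nz sq by simp
qed

fun gen_op :: "gen \<Rightarrow> complex \<times> complex \<Rightarrow> (complex \<times> complex \<Rightarrow>\<^sub>0 complex)" where
  "gen_op G21 (l, m) = (\<i> * n m) *\<^sub>C ket l m"
| "gen_op G32 (l, m) = coeff_a h l m *\<^sub>C ket l (m + 1) - ket l (m - 1)"
| "gen_op G43 (l, m) = coeff_b h p r l m *\<^sub>C ket (l + 1) m - n (l - m) *\<^sub>C ket (l - 1) m
    + (\<i> * coeff_c h p r l m) *\<^sub>C ket l m"

lemma lin_ket: "lin T (ket l m) = T (l, m)"
  by (simp add: ket_def lin_single)

lemma cscale_uminus_left: "(- c) *\<^sub>C x = - (c *\<^sub>C x)"
  by (rule poly_mapping_eqI) (simp add: lookup_cscale)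

text \<open>
  Up to a common factor, consecutive values of \<open>c_factor\<close> are the q-numbers \<open>[l+2]\<close> and \<open>[l]\<close>, whose
  sum is \<open>[2][l+1]\<close>; this brings the displacement \<open>\<plusminus>1\<close> equations to the form of \<open>qnum_three_term\<close>.
\<close>

lemma c_factor_step:
  assumes "l \<in> int_translates l0"
  shows "\<exists>\<kappa>. c_factor l = \<kappa> * n (l + 2) \<and> c_factor (l + 1) = \<kappa> * n l"
proof -
  note nz = qnum_l_nonzero[OF assms] qnum_l_nonzero[OF int_translates_step(1)[OF assms]]
  show ?thesis
    by (rule exI[of _ "n (p + 1) * n r / (n l * n (l + 1) * n (l + 2))"])
      (use nz in \<open>simp add: c_factor_def add.assoc\<close>)
qed

lemma c_factor_up_relation:
  assumes l: "l \<in> int_translates l0" and lt: "l = t + m"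
  shows "(n t * n (m + 1) + n (t + 1) * n m) * (c_factor l + c_factor (l + 1))
    = n 2 * (n (t + 1) * n (m + 1) * c_factor (l + 1) + n t * n m * c_factor l)"
proof -
  obtain \<kappa> where "c_factor l = \<kappa> * n (l + 2)" "c_factor (l + 1) = \<kappa> * n l"
    using c_factor_step[OF l] by blast
  moreover have "n 2 * n (l + 1) = n (l + 2) + n l"
    using two_times_qnum[of "l + 1"] by (simp add: add.assoc)
  moreover note qnum_three_term[OF lt]
  ultimately show ?thesis by Groebner_Basis.algebra
qed

text \<open>
  The mirror image of \<open>c_factor_up_relation\<close> under \<open>l \<mapsto> - l - 1\<close>, which fixes \<open>[l][l+1]\<close>.
\<close>

lemma c_factor_down_relation:
  assumes l: "l \<in> int_translates l0" and ls: "l = s - m"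
  shows "(n (s + 1) * n (m + 1) + n s * n m) * (c_factor l + c_factor (l - 1))
    = n 2 * (n s * n (m + 1) * c_factor (l - 1) + n (s + 1) * n m * c_factor l)"
proof -
  obtain \<kappa> where "c_factor (l - 1) = \<kappa> * n (l + 1)" "c_factor l = \<kappa> * n (l - 1)"
    using c_factor_step[OF int_translates_step(2)[OF l]] by (auto simp: add.commute)
  moreover have "n 2 * n l = n (l + 1) + n (l - 1)"
    by (rule two_times_qnum)
  moreover have "n l * (n (s + 1) * n (m + 1) + n s * n m)
      = n s * n (m + 1) * n (l + 1) + n (s + 1) * n m * n (l - 1)"
  proof -
    have neg: "n (- s - 1) = - n (s + 1)" "n (- s - 1 + 1) = - n s" "n (- l - 1) = - n (l + 1)"
      "n (- l - 1 + 1) = - n l" "n (- l - 1 + 2) = - n (l - 1)"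
      by (rule qnum_eq_minus; simp)+
    have "- l - 1 = - s - 1 + m" using ls by simp
    from qnum_three_term[OF this] show ?thesis
      unfolding neg by Groebner_Basis.algebra
  qed
  ultimately show ?thesis by Groebner_Basis.algebra
qed

lemma qnum_neighbours_quadratic: "(n (m + 1))\<^sup>2 - n 2 * n m * n (m + 1) + (n m)\<^sup>2 = 1"
proof -
  have "(n m)\<^sup>2 - n (m + 1) * n (m - 1) = 1"
    using qnum_mult_exchange[of m "m - 1"] by (simp add: qnum_1 power2_eq_square)
  with two_times_qnum[of m] show ?thesis by Groebner_Basis.algebra
qed

text \<open>
  The displacement-zero equation of the relation quadratic in \<open>I\<^sub>4\<^sub>3\<close>. Its three brackets are in fact
  \<open>[2l+3]\<close>, \<open>- [2l-1]\<close> and \<open>1\<close>, which leaves \<open>b_factor_relation\<close>. The label \<open>m\<close> is arbitrary here,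
  because the equation for the lowering part of \<open>I\<^sub>3\<^sub>2\<close> arises by replacing \<open>m\<close> by \<open>- m\<close>.
\<close>

lemma b_factor_level_relation:
  assumes l: "l \<in> int_translates l0"
  shows "b_factor l * (n 2 * n (l + m + 2) * n (l - m + 1) - n (l + m + 2) * n (l - m) - n (l + m + 1) * n (l - m + 1))
    + b_factor (l - 1) * (n 2 * n (l + m) * n (l - m - 1) - n (l - m - 1) * n (l + m + 1) - n (l - m) * n (l + m))
    - (c_factor l)\<^sup>2 * ((n (m + 1))\<^sup>2 - n 2 * n m * n (m + 1) + (n m)\<^sup>2) + 1 = 0"
proof -
  have "n 2 * n (l - m + 1) = n (l - m + 2) + n (l - m)"
    using two_times_qnum[of "l - m + 1"] by (simp add: add.assoc)
  moreover have "n (l + m + 2) * n (l - m + 2) = n (l + m + 1) * n (l - m + 1) + n (2 * l + 3)"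
    using qnum_mult_shift_1[of "l + m + 1" "l - m + 1"] by (simp add: algebra_simps)
  ultimately have 1: "n 2 * n (l + m + 2) * n (l - m + 1) - n (l + m + 2) * n (l - m)
      - n (l + m + 1) * n (l - m + 1) = n (2 * l + 3)"
    by Groebner_Basis.algebra
  have "n 2 * n (l + m) = n (l + m + 1) + n (l + m - 1)"
    by (rule two_times_qnum)
  moreover have "n (l + m) * n (l - m) = n (l + m - 1) * n (l - m - 1) + n (2 * l - 1)"
    using qnum_mult_shift_1[of "l + m - 1" "l - m - 1"] by (simp add: algebra_simps)
  ultimately have 2: "n 2 * n (l + m) * n (l - m - 1) - n (l - m - 1) * n (l + m + 1) - n (l - m) * n (l + m)
      = - n (2 * l - 1)"
    by Groebner_Basis.algebra
  show ?thesis
    unfolding 1 2 qnum_neighbours_quadratic using b_factor_relation[OF l] by simp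
qed

text \<open>
  The operator \<open>I\<^sub>3\<^sub>2\<close> is split into its raising and lowering parts in \<open>m\<close>; \<open>I\<^sub>4\<^sub>3\<close> moves along the chains
  in the direction of \<open>l\<close>. Up to common factors, the equations for the lowering part are those for the
  raising part with \<open>m\<close> replaced by \<open>- m\<close>.
\<close>

lemma serre_43_32:
  assumes l: "l \<in> int_translates l0"
  shows "serre_op (n 2) (lin (gen_op G43)) (lin (gen_op G32)) (ket l m) = 0"
proof -
  define T1 where "T1 = (\<lambda>(l, m). coeff_a h l m *\<^sub>C ket l (m + 1))"
  define T2 where "T2 = (\<lambda>(l, m). (- 1) *\<^sub>C ket l (m - 1))"
  have T: "gen_op G32 = (\<lambda>k. T1 k + T2 k)"
    by (auto simp: T1_def T2_def cscale_uminus_left)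
  have "serre_op (n 2) (lin (gen_op G43)) (lin T1) (ket l m) = 0"
  proof (rule serre_op_chain[where \<phi> = "\<lambda>l. ket l m" and \<psi> = "\<lambda>l. ket l (m + 1)" and k = l
        and b = "\<lambda>l. b_factor l * n (l + m + 1)" and d = "\<lambda>l. - n (l - m)"
        and e = "\<lambda>l. \<i> * c_factor l * n m"
        and b' = "\<lambda>l. b_factor l * n (l + m + 2)" and d' = "\<lambda>l. - n (l - m - 1)"
        and e' = "\<lambda>l. \<i> * c_factor l * n (m + 1)"
        and f = "\<lambda>l. a_factor m * n (l + m + 1) * n (l - m)"], goal_cases)
    \<comment> \<open>Cases 4 to 8 are the displacements 2, 1, 0, -1, -2 along the chain.\<close>
    case 4
    show ?case
      using two_times_qnum[of "l - m + 1"]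
      by (simp add: algebra_simps) Groebner_Basis.algebra
  next
    case 5
    show ?case
      using c_factor_up_relation[OF l, of "l - m" m]
      by (simp add: algebra_simps) Groebner_Basis.algebra
  next
    case 6
    show ?case
      using b_factor_level_relation[OF l, of m]
      by (simp add: algebra_simps power2_eq_square) Groebner_Basis.algebra
  next
    case 7
    show ?case
      using c_factor_down_relation[OF l, of "l + m" m]
      by (simp add: algebra_simps) Groebner_Basis.algebra
  next
    case 8
    show ?case
      using two_times_qnum[of "l + m"]
      by (simp add: algebra_simps) Groebner_Basis.algebra
  qed (simp_all add: lin_ket T1_def coeff_a_eq coeff_b_eq coeff_c_eq
      cscale_uminus_left add.assoc diff_diff_eq mult.assoc)
  moreover have "serre_op (n 2) (lin (gen_op G43)) (lin T2) (ket l m) = 0"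
  proof (rule serre_op_chain[where \<phi> = "\<lambda>l. ket l m" and \<psi> = "\<lambda>l. ket l (m - 1)" and k = l
        and b = "\<lambda>l. b_factor l * n (l + m + 1)" and d = "\<lambda>l. - n (l - m)"
        and e = "\<lambda>l. \<i> * c_factor l * n m"
        and b' = "\<lambda>l. b_factor l * n (l + m)" and d' = "\<lambda>l. - n (l - m + 1)"
        and e' = "\<lambda>l. \<i> * c_factor l * n (m - 1)"
        and f = "\<lambda>l. - 1"], goal_cases)
    case 4
    show ?case
      using two_times_qnum[of "l + m + 1"]
      by (simp add: algebra_simps) Groebner_Basis.algebra
  next
    case 5
    show ?case
      using c_factor_up_relation[OF l, of "l + m" "- m"]
        qnum_minus[of h m] qnum_minus[of h "m - 1"]
      by (simp add: algebra_simps) Groebner_Basis.algebra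
  next
    case 6
    show ?case
      using b_factor_level_relation[OF l, of "- m"]
        qnum_minus[of h m] qnum_minus[of h "m - 1"]
      by (simp add: algebra_simps power2_eq_square)
  next
    case 7
    show ?case
      using c_factor_down_relation[OF l, of "l - m" "- m"]
        qnum_minus[of h m] qnum_minus[of h "m - 1"]
      by (simp add: algebra_simps) Groebner_Basis.algebra
  next
    case 8
    show ?case using two_times_qnum[of "l - m"] by (simp add: algebra_simps)
  qed (simp_all add: lin_ket T2_def coeff_a_eq coeff_b_eq coeff_c_eq
      cscale_uminus_left algebra_simps)
  ultimately show ?thesis
    unfolding T serre_op_plus by simp
qed

text \<open>
  The displacement-zero equation for the part of \<open>I\<^sub>4\<^sub>3\<close> that raises \<open>l\<close>, divided by the coefficient of
  that part. The brackets are \<open>- [2m+2]\<close> and \<open>[2m-2]\<close>.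
\<close>

lemma a_factor_up_relation:
  assumes m: "m \<in> int_translates m0"
  shows "a_factor m * (n 2 * n (l + m + 2) * n (l - m) - n (l + m + 2) * n (l - m + 1) - n (l + m + 1) * n (l - m))
    + a_factor (m - 1) * (n 2 * n (l + m) * n (l - m + 2) - n (l + m + 1) * n (l - m + 2) - n (l + m) * n (l - m + 1))
    + 1 = 0"
proof -
  have "n 2 * n (l - m) = n (l - m + 1) + n (l - m - 1)"
    by (rule two_times_qnum)
  moreover have "n (l + m + 2) * n (l - m - 1) = n (l + m + 1) * n (l - m) - n (2 * m + 2)"
    using qnum_mult_exchange[of "l + m + 1" "l - m - 1"] by (simp add: algebra_simps)
  ultimately have 1: "n 2 * n (l + m + 2) * n (l - m) - n (l + m + 2) * n (l - m + 1)
      - n (l + m + 1) * n (l - m) = - n (2 * m + 2)"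
    by Groebner_Basis.algebra
  have "n 2 * n (l + m) = n (l + m + 1) + n (l + m - 1)"
    by (rule two_times_qnum)
  moreover have "n (l + m) * n (l - m + 1) = n (l + m - 1) * n (l - m + 2) - n (2 * m - 2)"
    using qnum_mult_exchange[of "l + m - 1" "l - m + 1"] by (simp add: algebra_simps)
  ultimately have 2: "n 2 * n (l + m) * n (l - m + 2) - n (l + m + 1) * n (l - m + 2)
      - n (l + m) * n (l - m + 1) = n (2 * m - 2)"
    by Groebner_Basis.algebra
  show ?thesis
    unfolding 1 2 using a_factor_relation[OF m] by Groebner_Basis.algebra
qed

text \<open>
  For the part of \<open>I\<^sub>4\<^sub>3\<close> that lowers \<open>l\<close>, apply \<open>l \<mapsto> - l - 1\<close> to \<open>a_factor_up_relation\<close>.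
\<close>

lemma a_factor_down_relation:
  assumes m: "m \<in> int_translates m0"
  shows "a_factor m * (n 2 * n (l + m + 1) * n (l - m - 1) - n (l + m) * n (l - m - 1) - n (l + m + 1) * n (l - m))
    + a_factor (m - 1) * (n 2 * n (l + m - 1) * n (l - m + 1) - n (l + m - 1) * n (l - m) - n (l + m) * n (l - m + 1))
    + 1 = 0"
proof -
  have neg: "n (- l - 1 + m + 2) = - n (l - m - 1)" "n (- l - 1 - m) = - n (l + m + 1)"
    "n (- l - 1 - m + 1) = - n (l + m)" "n (- l - 1 + m + 1) = - n (l - m)"
    "n (- l - 1 + m) = - n (l - m + 1)" "n (- l - 1 - m + 2) = - n (l + m - 1)"
    by (rule qnum_eq_minus; simp)+
  show ?thesis
    using a_factor_up_relation[OF m, of "- l - 1"] unfolding neg by (simp add: algebra_simps)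
qed

lemma serre_32_weight:
  assumes m: "m \<in> int_translates m0"
  shows "serre_op (n 2) (lin (gen_op G32)) (lin (\<lambda>(l, m). (\<kappa> l * n m) *\<^sub>C ket l m)) (ket l m) = 0"
proof (rule serre_op_chain[where \<phi> = "\<lambda>m. ket l m" and \<psi> = "\<lambda>m. ket l m" and k = m
        and b = "\<lambda>m. a_factor m * n (l + m + 1) * n (l - m)" and d = "\<lambda>m. - 1"
        and e = "\<lambda>m. 0"
        and b' = "\<lambda>m. a_factor m * n (l + m + 1) * n (l - m)" and d' = "\<lambda>m. - 1"
        and e' = "\<lambda>m. 0"
        and f = "\<lambda>m. \<kappa> l * n m"], goal_cases)
  case 4
  show ?case
    using two_times_qnum[of "m + 1"]
    by (simp add: algebra_simps) Groebner_Basis.algebra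
next
  case 6
  show ?case using a_factor_weight_relation[OF m, of l] two_times_qnum[of "m + 1"] two_times_qnum[of "m - 1"]
    by (simp add: algebra_simps) Groebner_Basis.algebra
next
  case 8
  show ?case using two_times_qnum[of "m - 1"] by (simp add: algebra_simps)
qed (simp_all add: lin_ket coeff_a_eq cscale_uminus_left add.assoc diff_diff_eq mult.assoc)

lemma serre_32_21:
  assumes m: "m \<in> int_translates m0"
  shows "serre_op (n 2) (lin (gen_op G32)) (lin (gen_op G21)) (ket l m) = 0"
proof -
  have "gen_op G21 = (\<lambda>(l, m). (\<i> * n m) *\<^sub>C ket l m)" by auto
  with serre_32_weight[OF m, of "\<lambda>l. \<i>" l] show ?thesis by simp
qed

lemma serre_21_32: "serre_op (n 2) (lin (gen_op G21)) (lin (gen_op G32)) (ket l m) = 0"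
proof -
  define T1 where "T1 = (\<lambda>(l, m). coeff_a h l m *\<^sub>C ket l (m + 1))"
  define T2 where "T2 = (\<lambda>(l, m). (- 1) *\<^sub>C ket l (m - 1))"
  have T: "gen_op G32 = (\<lambda>k. T1 k + T2 k)"
    by (auto simp: T1_def T2_def cscale_uminus_left)
  have "serre_op (n 2) (lin (gen_op G21)) (lin T1) (ket l m) = 0"
  proof (rule serre_op_chain[where \<phi> = "\<lambda>l. ket l m" and \<psi> = "\<lambda>l. ket l (m + 1)" and k = l
        and b = "\<lambda>l. 0" and d = "\<lambda>l. 0" and e = "\<lambda>l. \<i> * n m"
        and b' = "\<lambda>l. 0" and d' = "\<lambda>l. 0"
        and e' = "\<lambda>l. \<i> * n (m + 1)"
        and f = "\<lambda>l. coeff_a h l m"], goal_cases)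
    case 6
    show ?case
      using qnum_neighbours_quadratic[of m]
      by (simp add: algebra_simps power2_eq_square) Groebner_Basis.algebra
  qed (simp_all add: lin_ket T1_def)
  moreover have "serre_op (n 2) (lin (gen_op G21)) (lin T2) (ket l m) = 0"
  proof (rule serre_op_chain[where \<phi> = "\<lambda>l. ket l m" and \<psi> = "\<lambda>l. ket l (m - 1)" and k = l
        and b = "\<lambda>l. 0" and d = "\<lambda>l. 0" and e = "\<lambda>l. \<i> * n m"
        and b' = "\<lambda>l. 0" and d' = "\<lambda>l. 0"
        and e' = "\<lambda>l. \<i> * n (m - 1)"
        and f = "\<lambda>l. - 1"], goal_cases)
    case 6
    show ?case
      using qnum_neighbours_quadratic[of "m - 1"]
      by (simp add: algebra_simps power2_eq_square)
  qed (simp_all add: lin_ket T2_def)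
  ultimately show ?thesis
    unfolding T serre_op_plus by simp
qed

text \<open>
  Now \<open>I\<^sub>3\<^sub>2\<close> moves along the chains in the direction of \<open>m\<close>, and \<open>I\<^sub>4\<^sub>3\<close> is split into the parts that
  raise, lower and preserve \<open>l\<close>. The last one is a multiple of \<open>I\<^sub>2\<^sub>1\<close> on each \<open>l\<close>.
\<close>

lemma serre_32_43:
  assumes m: "m \<in> int_translates m0"
  shows "serre_op (n 2) (lin (gen_op G32)) (lin (gen_op G43)) (ket l m) = 0"
proof -
  define T1 where "T1 = (\<lambda>(l, m). (b_factor l * n (l + m + 1)) *\<^sub>C ket (l + 1) m)"
  define T2 where "T2 = (\<lambda>(l, m). (- n (l - m)) *\<^sub>C ket (l - 1) m)"
  define T3 where "T3 = (\<lambda>(l, m). (\<i> * c_factor l * n m) *\<^sub>C ket l m)"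
  have T: "gen_op G43 = (\<lambda>k. (T1 k + T2 k) + T3 k)"
    by (auto simp: T1_def T2_def T3_def coeff_b_eq coeff_c_eq cscale_uminus_left mult.assoc)
  have "serre_op (n 2) (lin (gen_op G32)) (lin T1) (ket l m) = 0"
  proof (rule serre_op_chain[where \<phi> = "\<lambda>m. ket l m" and \<psi> = "\<lambda>m. ket (l + 1) m" and k = m
        and b = "\<lambda>m. a_factor m * n (l + m + 1) * n (l - m)" and d = "\<lambda>m. - 1"
        and e = "\<lambda>m. 0"
        and b' = "\<lambda>m. a_factor m * n (l + m + 2) * n (l - m + 1)" and d' = "\<lambda>m. - 1"
        and e' = "\<lambda>m. 0"
        and f = "\<lambda>m. b_factor l * n (l + m + 1)"], goal_cases)
    case 1
    show ?case by (simp add: lin_ket coeff_a_eq cscale_uminus_left)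
  next
    case (2 m)
    show ?case by (simp add: lin_ket coeff_a_eq cscale_uminus_left algebra_simps)
  next
    case 3
    show ?case by (simp add: lin_ket T1_def)
  next
    case 4
    show ?case
      using two_times_qnum[of "l - m"]
      by (simp add: algebra_simps) Groebner_Basis.algebra
  next
    case 6
    show ?case
      using a_factor_up_relation[OF m, of l]
      by (simp add: algebra_simps) Groebner_Basis.algebra
  next
    case 8
    show ?case
      using two_times_qnum[of "l + m"]
      by (simp add: algebra_simps) Groebner_Basis.algebra
  qed simp_all
  moreover have "serre_op (n 2) (lin (gen_op G32)) (lin T2) (ket l m) = 0"
  proof (rule serre_op_chain[where \<phi> = "\<lambda>m. ket l m" and \<psi> = "\<lambda>m. ket (l - 1) m" and k = m
        and b = "\<lambda>m. a_factor m * n (l + m + 1) * n (l - m)" and d = "\<lambda>m. - 1"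
        and e = "\<lambda>m. 0"
        and b' = "\<lambda>m. a_factor m * n (l + m) * n (l - m - 1)" and d' = "\<lambda>m. - 1"
        and e' = "\<lambda>m. 0"
        and f = "\<lambda>m. - n (l - m)"], goal_cases)
    case 1
    show ?case by (simp add: lin_ket coeff_a_eq cscale_uminus_left)
  next
    case (2 m)
    show ?case by (simp add: lin_ket coeff_a_eq cscale_uminus_left algebra_simps)
  next
    case 3
    show ?case by (simp add: lin_ket T2_def)
  next
    case 4
    show ?case
      using two_times_qnum[of "l + m + 1"]
      by (simp add: algebra_simps) Groebner_Basis.algebra
  next
    case 6
    show ?case
      using a_factor_down_relation[OF m, of l]
      by (simp add: algebra_simps) Groebner_Basis.algebra
  next
    case 8
    show ?case using two_times_qnum[of "l - m + 1"] by (simp add: algebra_simps)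
  qed simp_all
  moreover have "serre_op (n 2) (lin (gen_op G32)) (lin T3) (ket l m) = 0"
    unfolding T3_def by (rule serre_32_weight[OF m])
  ultimately show ?thesis
    unfolding T serre_op_plus by simp
qed

lemma commute_21_43: "lin (gen_op G21) (lin (gen_op G43) (ket l m)) = lin (gen_op G43) (lin (gen_op G21) (ket l m))"
  by (simp add: lin_ket lin_add lin_diff lin_cscale algebra_simps)

end

section \<open>From operators on basis vectors to representations\<close>

lemma lin_cscale_fun: "lin (\<lambda>k. c *\<^sub>C T k) v = c *\<^sub>C lin T v"
  by (simp add: lin_def cscale_sum mult.commute)

text \<open>
  By the universal property of the free algebra, operators for the generators determine an action
  of all noncommutative polynomials: words act by composition, and \<open>act\<close> is the linear extension.
\<close>

fun word_act :: "(gen \<Rightarrow> 'a \<Rightarrow> ('a \<Rightarrow>\<^sub>0 complex)) \<Rightarrow> gword \<Rightarrow> ('a \<Rightarrow>\<^sub>0 complex) \<Rightarrow> ('a \<Rightarrow>\<^sub>0 complex)" where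
  "word_act T (Word gs) v = foldr (\<lambda>g. lin (T g)) gs v"

definition act :: "(gen \<Rightarrow> 'a \<Rightarrow> ('a \<Rightarrow>\<^sub>0 complex)) \<Rightarrow> freepoly \<Rightarrow> ('a \<Rightarrow>\<^sub>0 complex) \<Rightarrow> ('a \<Rightarrow>\<^sub>0 complex)" where
  "act T f v = lin (\<lambda>w. word_act T w v) f"

lemma word_act_0: "word_act T 0 v = v"
  by (simp add: zero_gword_def)

lemma word_act_plus: "word_act T (u + w) v = word_act T u (word_act T w v)"
  by (cases u; cases w) simp

lemma word_act_linear:
  "word_act T w (v + v') = word_act T w v + word_act T w v'"
  "word_act T w (c *\<^sub>C v) = c *\<^sub>C word_act T w v"
proof -
  obtain gs where w: "w = Word gs" by (cases w)
  show "word_act T w (v + v') = word_act T w v + word_act T w v'"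
    unfolding w by (induction gs) (simp_all add: lin_add)
  show "word_act T w (c *\<^sub>C v) = c *\<^sub>C word_act T w v"
    unfolding w by (induction gs) (simp_all add: lin_cscale)
qed

lemma word_act_keys:
  assumes "\<And>g k. k \<in> S \<Longrightarrow> Poly_Mapping.keys (T g k) \<subseteq> S" "Poly_Mapping.keys v \<subseteq> S"
  shows "Poly_Mapping.keys (word_act T w v) \<subseteq> S"
proof -
  obtain gs where w: "w = Word gs" by (cases w)
  show ?thesis
    unfolding w using assms by (induction gs) (simp_all add: lin_keys)
qed

lemma act_plus_left: "act T (f + g) v = act T f v + act T g v"
  by (simp add: act_def lin_add)

lemma act_minus_left: "act T (f - g) v = act T f v - act T g v"
  by (simp add: act_def lin_diff)

lemma act_cscale_left: "act T (c *\<^sub>C f) v = c *\<^sub>C act T f v"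
  by (simp add: act_def lin_cscale)

lemma act_plus_right: "act T f (v + w) = act T f v + act T f w"
  by (simp add: act_def word_act_linear lin_plus)

lemma act_cscale_right: "act T f (c *\<^sub>C v) = c *\<^sub>C act T f v"
  by (simp add: act_def word_act_linear lin_cscale_fun)

lemma act_0_right: "act T f 0 = 0"
  using act_cscale_right[of T f 0 0] by simp

lemma act_word: "act T (Poly_Mapping.single w 1) v = word_act T w v"
  by (simp add: act_def lin_single)

lemma act_0: "act T 0 v = 0"
  by (simp add: act_def lin_0)

lemma act_1: "act T 1 v = v"
  using act_word[of T 0 v] by (simp add: word_act_0)

lemma act_gen: "act T (free_gen g) v = lin (T g) v"
  by (simp add: free_gen_def act_word)

lemma cscale_mult_left: "(c *\<^sub>C f) * g = c *\<^sub>C (f * g :: freepoly)"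
  by (simp add: cscale_conv_times mult.assoc)

lemma cscale_mult_right: "f * (c *\<^sub>C g) = c *\<^sub>C (f * g :: freepoly)"
proof -
  have "f * Poly_Mapping.single 0 c = Poly_Mapping.single 0 c * f"
  proof (induction f rule: poly_mapping_basis_induct)
    case (cscale d f)
    then show ?case
      by (simp add: cscale_mult_left) (simp add: cscale_conv_times mult_single flip: mult.assoc, simp add: mult.commute)
  qed (simp_all add: algebra_simps mult_single)
  then show ?thesis
    by (simp add: cscale_conv_times flip: mult.assoc)
qed

lemma act_mult: "act T (f * g) v = act T f (act T g v)"
proof (induction f rule: poly_mapping_basis_induct)
  case (basis w)
  show ?case
  proof (induction g rule: poly_mapping_basis_induct)
    case (basis w')
    show ?case
      by (simp add: mult_single act_word word_act_plus)
  qed (simp_all add: act_0 act_0_right distrib_left act_plus_left act_plus_right cscale_mult_right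
      act_cscale_left act_cscale_right)
qed (simp_all add: act_0 distrib_right act_plus_left cscale_mult_left act_cscale_left)

lemma act_keys:
  assumes "\<And>g k. k \<in> S \<Longrightarrow> Poly_Mapping.keys (T g k) \<subseteq> S" "Poly_Mapping.keys v \<subseteq> S"
  shows "Poly_Mapping.keys (act T f v) \<subseteq> S"
  unfolding act_def by (rule lin_keys[OF subset_UNIV]) (use word_act_keys[OF assms] in simp)

lemma act_serre_rel:
  "act T (serre_rel h (free_gen x) (free_gen y)) v = serre_op (qnum h 2) (lin (T x)) (lin (T y)) v"
  by (simp add: serre_rel_def serre_op_def act_plus_left act_minus_left act_cscale_left act_mult act_gen
      power2_eq_square mult.assoc)

lemma free_alg_simps [simp]:
  "carrier free_alg = UNIV" "x \<otimes>\<^bsub>free_alg\<^esub> y = x * y" "\<one>\<^bsub>free_alg\<^esub> = 1" "\<zero>\<^bsub>free_alg\<^esub> = 0"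
  "x \<oplus>\<^bsub>free_alg\<^esub> y = x + y"
  by (simp_all add: free_alg_def)

definition Uq_class :: "complex \<Rightarrow> freepoly \<Rightarrow> freepoly set" where
  "Uq_class h f = Uq_ideal h +>\<^bsub>free_alg\<^esub> f"

lemma carrier_Uq: "carrier (Uq_tw_so4 h) = range (Uq_class h)"
  by (auto simp: Uq_tw_so4_simps FactRing_def A_RCOSETS_def' Uq_class_def)

lemma Uq_class_hom:
  "Uq_class h (f + g) = Uq_class h f \<oplus>\<^bsub>Uq_tw_so4 h\<^esub> Uq_class h g"
  "Uq_class h (f * g) = Uq_class h f \<otimes>\<^bsub>Uq_tw_so4 h\<^esub> Uq_class h g"
  "Uq_class h 1 = \<one>\<^bsub>Uq_tw_so4 h\<^esub>"
  "Uq_class h (c *\<^sub>C f) = c \<odot>\<^bsub>Uq_tw_so4 h\<^esub> Uq_class h f"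
proof -
  note hom = ideal.rcos_ring_hom[OF ideal_Uq_ideal, of h]
  show "Uq_class h (f + g) = Uq_class h f \<oplus>\<^bsub>Uq_tw_so4 h\<^esub> Uq_class h g"
    "Uq_class h (f * g) = Uq_class h f \<otimes>\<^bsub>Uq_tw_so4 h\<^esub> Uq_class h g"
    "Uq_class h 1 = \<one>\<^bsub>Uq_tw_so4 h\<^esub>"
    using ring_hom_add[OF hom, of f g] ring_hom_mult[OF hom, of f g] ring_hom_one[OF hom]
    by (simp_all add: Uq_tw_so4_simps Uq_class_def)
  show "Uq_class h (c *\<^sub>C f) = c \<odot>\<^bsub>Uq_tw_so4 h\<^esub> Uq_class h f"
    unfolding Uq_class_def Uq_smult_coset ..
qed

lemma Uq_class_elem:
  assumes "g \<in> Uq_class h f" shows "g - f \<in> Uq_ideal h"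
  using assms by (auto simp: Uq_class_def a_r_coset_def')

lemma Uq_class_self: "f \<in> Uq_class h f"
proof -
  interpret I: ideal "Uq_ideal h" free_alg by (rule ideal_Uq_ideal)
  show ?thesis by (simp add: Uq_class_def I.a_rcos_self)
qed

lemma V_simps [simp]: "x \<oplus>\<^bsub>V_space l0 m0\<^esub> y = x + y" "c \<odot>\<^bsub>V_space l0 m0\<^esub> x = c *\<^sub>C x" "\<zero>\<^bsub>V_space l0 m0\<^esub> = 0"
  by (simp_all add: V_space_def)

lemma carrier_V: "v \<in> carrier (V_space l0 m0) \<longleftrightarrow> Poly_Mapping.keys v \<subseteq> int_translates l0 \<times> int_translates m0"
  by (simp add: V_space_def)

lemma V_closed:
  "v \<in> carrier (V_space l0 m0) \<Longrightarrow> w \<in> carrier (V_space l0 m0) \<Longrightarrow> v + w \<in> carrier (V_space l0 m0)"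
  "v \<in> carrier (V_space l0 m0) \<Longrightarrow> w \<in> carrier (V_space l0 m0) \<Longrightarrow> v - w \<in> carrier (V_space l0 m0)"
  "v \<in> carrier (V_space l0 m0) \<Longrightarrow> c *\<^sub>C v \<in> carrier (V_space l0 m0)"
  "0 \<in> carrier (V_space l0 m0)"
  "l \<in> int_translates l0 \<Longrightarrow> m \<in> int_translates m0 \<Longrightarrow> ket l m \<in> carrier (V_space l0 m0)"
  using keys_add[of v w] keys_diff[of v w] keys_cscale[of c v] by (auto simp: carrier_V ket_def)

lemma V_induct [consumes 1, case_names zero add cscale ket]:
  assumes "v \<in> carrier (V_space l0 m0)"
    and "P 0"
    and "\<And>v w. v \<in> carrier (V_space l0 m0) \<Longrightarrow> w \<in> carrier (V_space l0 m0) \<Longrightarrow> P v \<Longrightarrow> P w \<Longrightarrow> P (v + w)"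
    and "\<And>c v. v \<in> carrier (V_space l0 m0) \<Longrightarrow> P v \<Longrightarrow> P (c *\<^sub>C v)"
    and "\<And>l m. l \<in> int_translates l0 \<Longrightarrow> m \<in> int_translates m0 \<Longrightarrow> P (ket l m)"
  shows "P v"
  using assms(1)[unfolded carrier_V]
  by (induction v rule: basis_induct) (auto simp: ket_def carrier_V intro: assms[unfolded carrier_V ket_def])

lemma End_alg_eqI:
  assumes f: "f \<in> carrier (End_alg (V_space l0 m0))" and g: "g \<in> carrier (End_alg (V_space l0 m0))"
    and eq: "\<And>l m. l \<in> int_translates l0 \<Longrightarrow> m \<in> int_translates m0 \<Longrightarrow> f (ket l m) = g (ket l m)"
  shows "f = g"
proof -
  have lin: "\<phi> (v + w) = \<phi> v + \<phi> w" "\<phi> (c *\<^sub>C v) = c *\<^sub>C \<phi> v"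
    if "\<phi> \<in> {f, g}" "v \<in> carrier (V_space l0 m0)" "w \<in> carrier (V_space l0 m0)" for \<phi> v w c
    using that f g by (auto simp: End_alg_def)
  have "f v = g v" if "v \<in> carrier (V_space l0 m0)" for v
    using that
  proof (induction v rule: V_induct)
    case zero
    show ?case using lin(2)[of f 0 0 0] lin(2)[of g 0 0 0] V_closed(4) by simp
  qed (simp_all add: lin eq V_closed(4))
  moreover have "f \<in> extensional (carrier (V_space l0 m0))" "g \<in> extensional (carrier (V_space l0 m0))"
    using f g by (auto simp: End_alg_def PiE_def)
  ultimately show ?thesis by (meson extensionalityI)
qed

text \<open>
  The products of generators span the free algebra, hence their classes span its quotient.
\<close>

lemma alg_hom_eqI:
  assumes hom: "\<phi> \<in> alg_hom (Uq_tw_so4 h) (End_alg (V_space l0 m0))"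
      "\<phi>' \<in> alg_hom (Uq_tw_so4 h) (End_alg (V_space l0 m0))"
    and ext: "\<phi> \<in> extensional (carrier (Uq_tw_so4 h))" "\<phi>' \<in> extensional (carrier (Uq_tw_so4 h))"
    and gen: "\<And>g. \<phi> (Uq_gen h g) = \<phi>' (Uq_gen h g)"
  shows "\<phi> = \<phi>'"
proof -
  let ?E = "End_alg (V_space l0 m0)"
  have hom': "\<psi> (Uq_class h (f + g)) = \<psi> (Uq_class h f) \<oplus>\<^bsub>?E\<^esub> \<psi> (Uq_class h g)"
    "\<psi> (Uq_class h (f * g)) = \<psi> (Uq_class h f) \<otimes>\<^bsub>?E\<^esub> \<psi> (Uq_class h g)"
    "\<psi> (Uq_class h 1) = \<one>\<^bsub>?E\<^esub>"
    "\<psi> (Uq_class h (c *\<^sub>C f)) = c \<odot>\<^bsub>?E\<^esub> \<psi> (Uq_class h f)"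
    if "\<psi> \<in> {\<phi>, \<phi>'}" for \<psi> f g c
    using that hom
    by (auto simp: alg_hom_def Uq_class_hom carrier_Uq ring_hom_add ring_hom_mult ring_hom_one)
  have word: "\<phi> (Uq_class h (Poly_Mapping.single (Word gs) 1)) = \<phi>' (Uq_class h (Poly_Mapping.single (Word gs) 1))" for gs
  proof (induction gs)
    case Nil
    have "Poly_Mapping.single (Word []) 1 = (1 :: freepoly)"
      by (simp flip: zero_gword_def)
    then show ?case by (simp add: hom'(3))
  next
    case (Cons g gs)
    have "Poly_Mapping.single (Word (g # gs)) 1 = free_gen g * Poly_Mapping.single (Word gs) 1"
      by (simp add: free_gen_def mult_single)
    then show ?case
      using Cons gen[of g] by (simp add: hom'(2) Uq_gen_def Uq_class_def[symmetric])
  qed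
  have "\<phi> (Uq_class h f) = \<phi>' (Uq_class h f)" for f
  proof (induction f rule: poly_mapping_basis_induct)
    case zero
    show ?case
      using hom'(4)[of \<phi> 0 0] hom'(4)[of \<phi>' 0 0]
      by (simp add: End_alg_def)
  next
    case (basis w)
    show ?case using word by (cases w) simp
  qed (simp_all add: hom')
  then show ?thesis
    by (intro extensionalityI[OF ext]) (auto simp: carrier_Uq)
qed

text \<open>
  Every class acts through an arbitrary one of its representatives; the choice does not matter once
  the relators act as zero (\<open>uq_rep_class\<close>).
\<close>

definition uq_rep :: "(gen \<Rightarrow> complex \<times> complex \<Rightarrow> (complex \<times> complex \<Rightarrow>\<^sub>0 complex)) \<Rightarrow> complex \<Rightarrow> complex \<Rightarrow> complex
   \<Rightarrow> freepoly set \<Rightarrow> (complex \<times> complex \<Rightarrow>\<^sub>0 complex) \<Rightarrow> (complex \<times> complex \<Rightarrow>\<^sub>0 complex)" where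
  "uq_rep T h l0 m0 = (\<lambda>X\<in>carrier (Uq_tw_so4 h). \<lambda>v\<in>carrier (V_space l0 m0). act T (SOME f. f \<in> X) v)"

lemma uq_rep_extensional: "uq_rep T h l0 m0 \<in> extensional (carrier (Uq_tw_so4 h))"
  by (simp add: uq_rep_def)

context
  fixes T h l0 m0
  assumes stable: "\<And>g k. k \<in> int_translates l0 \<times> int_translates m0 \<Longrightarrow>
      Poly_Mapping.keys (T g k) \<subseteq> int_translates l0 \<times> int_translates m0"
    and relators: "\<And>f l m. f \<in> Uq_relators h \<Longrightarrow> l \<in> int_translates l0 \<Longrightarrow> m \<in> int_translates m0 \<Longrightarrow>
      act T f (ket l m) = 0"
begin

lemma act_V_closed: "v \<in> carrier (V_space l0 m0) \<Longrightarrow> act T f v \<in> carrier (V_space l0 m0)"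
  using act_keys[OF stable] by (simp add: carrier_V)

text \<open>
  The polynomials that annihilate the space form a two-sided ideal, which contains the relators and
  hence the ideal they generate.
\<close>

lemma Uq_ideal_act:
  assumes "f \<in> Uq_ideal h" "v \<in> carrier (V_space l0 m0)" shows "act T f v = 0"
proof -
  let ?J = "{f. \<forall>v\<in>carrier (V_space l0 m0). act T f v = 0}"
  have "ideal ?J free_alg"
  proof (rule idealI[OF ring_free_alg])
    show "subgroup ?J (add_monoid free_alg)"
    proof (rule group.subgroupI)
      show "Group.group (add_monoid free_alg)"
        by (rule abelian_group.a_group[OF ring.is_abelian_group[OF ring_free_alg]])
      show "?J \<noteq> {}" using act_0 by blast
      show "inv\<^bsub>add_monoid free_alg\<^esub> f \<in> ?J" if "f \<in> ?J" for f
      proof -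
        have "inv\<^bsub>add_monoid free_alg\<^esub> f = - f"
          by (rule comm_monoid.comm_inv_char[OF abelian_monoid.a_comm_monoid])
            (simp_all add: abelian_group.axioms(1)[OF ring.is_abelian_group[OF ring_free_alg]])
        then show ?thesis
          using that act_minus_left[of T 0 f] by (simp add: act_0)
      qed
    qed (auto simp: act_plus_left)
  qed (auto simp: act_mult act_0_right act_V_closed)
  moreover have "Uq_relators h \<subseteq> ?J"
  proof (intro subsetI CollectI ballI)
    fix f v assume f: "f \<in> Uq_relators h" and "v \<in> carrier (V_space l0 m0)"
    from this(2) show "act T f v = 0"
      by (induction v rule: V_induct) (simp_all add: act_0_right act_plus_right act_cscale_right relators[OF f])
  qed
  ultimately have "Uq_ideal h \<subseteq> ?J"
    unfolding Uq_ideal_def by (rule ring.genideal_minimal[OF ring_free_alg])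
  with assms show ?thesis by blast
qed

lemma uq_rep_class: "uq_rep T h l0 m0 (Uq_class h f) = (\<lambda>v\<in>carrier (V_space l0 m0). act T f v)"
proof -
  let ?g = "SOME g. g \<in> Uq_class h f"
  have "?g - f \<in> Uq_ideal h"
    by (rule Uq_class_elem[OF someI[of "\<lambda>g. g \<in> Uq_class h f", OF Uq_class_self]])
  then have "act T ?g v = act T f v" if "v \<in> carrier (V_space l0 m0)" for v
    using Uq_ideal_act[OF _ that] act_minus_left[of T ?g f v] by simp
  then show ?thesis
    by (auto simp: uq_rep_def carrier_Uq intro!: restrict_ext)
qed

lemma uq_rep_alg_hom: "uq_rep T h l0 m0 \<in> alg_hom (Uq_tw_so4 h) (End_alg (V_space l0 m0))"
  unfolding alg_hom_def
proof (intro CollectI conjI allI ballI ring_hom_memI)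
  fix X assume "X \<in> carrier (Uq_tw_so4 h)"
  then obtain f where X: "X = Uq_class h f" by (auto simp: carrier_Uq)
  show "uq_rep T h l0 m0 X \<in> carrier (End_alg (V_space l0 m0))"
    by (auto simp: X uq_rep_class End_alg_def act_V_closed act_plus_right act_cscale_right V_closed)
  show "uq_rep T h l0 m0 (c \<odot>\<^bsub>Uq_tw_so4 h\<^esub> X) = c \<odot>\<^bsub>End_alg (V_space l0 m0)\<^esub> uq_rep T h l0 m0 X" for c
    unfolding X Uq_class_hom(4)[symmetric] uq_rep_class
    by (auto simp: End_alg_def act_cscale_left intro!: restrict_ext)
  fix Y assume "Y \<in> carrier (Uq_tw_so4 h)"
  then obtain g where Y: "Y = Uq_class h g" by (auto simp: carrier_Uq)
  show "uq_rep T h l0 m0 (X \<otimes>\<^bsub>Uq_tw_so4 h\<^esub> Y) = uq_rep T h l0 m0 X \<otimes>\<^bsub>End_alg (V_space l0 m0)\<^esub> uq_rep T h l0 m0 Y"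
    unfolding X Y Uq_class_hom(2)[symmetric] uq_rep_class
    by (auto simp: End_alg_def compose_def act_mult act_V_closed intro!: restrict_ext)
  show "uq_rep T h l0 m0 (X \<oplus>\<^bsub>Uq_tw_so4 h\<^esub> Y) = uq_rep T h l0 m0 X \<oplus>\<^bsub>End_alg (V_space l0 m0)\<^esub> uq_rep T h l0 m0 Y"
    unfolding X Y Uq_class_hom(1)[symmetric] uq_rep_class
    by (auto simp: End_alg_def act_plus_left intro!: restrict_ext)
next
  show "uq_rep T h l0 m0 \<one>\<^bsub>Uq_tw_so4 h\<^esub> = \<one>\<^bsub>End_alg (V_space l0 m0)\<^esub>"
    unfolding Uq_class_hom(3)[symmetric] uq_rep_class
    by (auto simp: End_alg_def act_1 intro!: restrict_ext)
qed

lemma uq_rep_gen: "v \<in> carrier (V_space l0 m0) \<Longrightarrow> uq_rep T h l0 m0 (Uq_gen h g) v = lin (T g) v"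
  by (simp add: Uq_gen_def uq_rep_class[unfolded Uq_class_def] act_gen)

end

context so4_params begin

lemma gen_op_stable:
  assumes "k \<in> int_translates l0 \<times> int_translates m0"
  shows "Poly_Mapping.keys (gen_op g k) \<subseteq> int_translates l0 \<times> int_translates m0"
proof -
  obtain l m where k: "k = (l, m)" by (cases k)
  have "gen_op g (l, m) \<in> carrier (V_space l0 m0)"
    using assms by (cases g) (auto simp: k int_translates_step intro!: V_closed)
  then show ?thesis by (simp add: k carrier_V)
qed

lemma gen_op_relators:
  assumes "f \<in> Uq_relators h" "l \<in> int_translates l0" "m \<in> int_translates m0"
  shows "act gen_op f (ket l m) = 0"
proof -
  consider "f = free_gen G21 * free_gen G43 - free_gen G43 * free_gen G21"
    | "f = serre_rel h (free_gen G32) (free_gen G21)" | "f = serre_rel h (free_gen G21) (free_gen G32)"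
    | "f = serre_rel h (free_gen G43) (free_gen G32)" | "f = serre_rel h (free_gen G32) (free_gen G43)"
    using assms(1) unfolding Uq_relators_def by blast
  then show ?thesis
    by cases (simp_all add: act_minus_left act_mult act_gen commute_21_43 act_serre_rel serre_32_21 serre_21_32
        serre_43_32 serre_32_43 assms(2,3))
qed

end

text \<open>
  If \<open>q = q\<^sup>-\<^sup>1\<close>, then \<open>exp (2h) = 1\<close>, so \<open>h\<close> is \<open>2\<pi>i\<close> times a half-integer.
\<close>

lemma q_minus_inverse_nonzero:
  assumes "h \<notin> (\<lambda>t. 2 * of_real pi * \<i> * t) ` \<rat>"
  shows "qpow h 1 - qpow h (- 1) \<noteq> 0"
proof
  assume "qpow h 1 - qpow h (- 1) = 0"
  then have "exp h * exp h = exp h * exp (- h)" by (simp add: qpow_def)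
  then have 1: "exp (2 * h) = 1" by (simp flip: exp_add)
  then have "Re h = 0"
    using norm_exp_eq_Re[of "2 * h"] by simp
  moreover have "cos (2 * Im h) = 1"
    using arg_cong[OF 1, of Re] \<open>Re h = 0\<close> by (simp add: Re_exp)
  then obtain k :: int where "2 * Im h = of_int k * 2 * pi"
    unfolding cos_one_2pi_int by blast
  ultimately have "h = 2 * of_real pi * \<i> * (of_int k / 2)"
    by (simp add: complex_eq_iff)
  moreover have "(of_int k / 2 :: complex) \<in> \<rat>" by simp
  ultimately show False using assms by blast
qed

theorem theorem4p2:
  fixes h p r l0 m0 :: complex
  assumes "h \<notin> (\<lambda>t. 2 * of_real pi * \<i> * t) ` \<rat>"
    and "\<forall>m \<in> int_translates m0. qpow h (2 * m) \<noteq> - 1"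
    and "\<forall>l \<in> int_translates l0. qpow h (2 * l) \<noteq> 1 \<and> qpow h (4 * l + 2) \<noteq> 1"
  shows "\<exists>!\<rho>. \<rho> \<in> extensional (carrier (Uq_tw_so4 h)) \<and>
    \<rho> \<in> alg_hom (Uq_tw_so4 h) (End_alg (V_space l0 m0)) \<and>
    (\<forall>l \<in> int_translates l0. \<forall>m \<in> int_translates m0.
      \<rho> (Uq_gen h G21) (ket l m) = (\<i> * qnum h m) *\<^sub>C ket l m \<and>
      \<rho> (Uq_gen h G32) (ket l m) = coeff_a h l m *\<^sub>C ket l (m + 1) - ket l (m - 1) \<and>
      \<rho> (Uq_gen h G43) (ket l m) =
        coeff_b h p r l m *\<^sub>C ket (l + 1) m - qnum h (l - m) *\<^sub>C ket (l - 1) m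
        + (\<i> * coeff_c h p r l m) *\<^sub>C ket l m)"
proof -
  interpret so4_params h p r l0 m0
    using assms q_minus_inverse_nonzero by unfold_locales auto
  have hom: "uq_rep gen_op h l0 m0 \<in> alg_hom (Uq_tw_so4 h) (End_alg (V_space l0 m0))"
    by (rule uq_rep_alg_hom[OF gen_op_stable gen_op_relators])
  have acts: "uq_rep gen_op h l0 m0 (Uq_gen h g) (ket l m) = gen_op g (l, m)"
    if "l \<in> int_translates l0" "m \<in> int_translates m0" for g l m
    using uq_rep_gen[OF gen_op_stable gen_op_relators V_closed(5)[OF that]] by (simp add: lin_ket)
  show ?thesis (is "\<exists>!\<rho>. ?R \<rho>")
  proof (rule ex1I[of _ "uq_rep gen_op h l0 m0"])
    show "?R (uq_rep gen_op h l0 m0)"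
      using hom by (simp add: acts uq_rep_extensional)
  next
    fix \<rho>
    assume \<rho>: "?R \<rho>"
    show "\<rho> = uq_rep gen_op h l0 m0"
    proof (rule alg_hom_eqI[OF _ hom])
      show \<rho>_hom: "\<rho> \<in> alg_hom (Uq_tw_so4 h) (End_alg (V_space l0 m0))"
        and "\<rho> \<in> extensional (carrier (Uq_tw_so4 h))"
        using \<rho> by simp_all
      show "uq_rep gen_op h l0 m0 \<in> extensional (carrier (Uq_tw_so4 h))"
        by (rule uq_rep_extensional)
      fix g
      have "Uq_gen h g \<in> carrier (Uq_tw_so4 h)"
        by (simp add: carrier_Uq Uq_gen_def flip: Uq_class_def)
      then have "\<rho> (Uq_gen h g) \<in> carrier (End_alg (V_space l0 m0))"
        "uq_rep gen_op h l0 m0 (Uq_gen h g) \<in> carrier (End_alg (V_space l0 m0))"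
        using \<rho>_hom hom by (auto simp: alg_hom_def ring_hom_closed)
      then show "\<rho> (Uq_gen h g) = uq_rep gen_op h l0 m0 (Uq_gen h g)"
      proof (rule End_alg_eqI)
        fix l m
        assume "l \<in> int_translates l0" "m \<in> int_translates m0"
        then show "\<rho> (Uq_gen h g) (ket l m) = uq_rep gen_op h l0 m0 (Uq_gen h g) (ket l m)"
          using \<rho> by (cases g) (simp_all add: acts)
      qed
    qed
  qed
qed

end
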